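(* Let $\mathcal H$ be a real Hilbert space, let $\varepsilon_0\in\,]0,1[$, and let $(\beta_n)_{n\in\mathbb N}$ be a sequence in $]0,1-\varepsilon_0]$. For every $n\in\mathbb N$, let $T_n\colon\mathcal H\to\mathcal H$ be firmly nonexpansive and let $R_n\colon \operatorname{dom}R_n\subset\mathcal H\to\mathcal H$ be pseudo contractive and such that $\operatorname{Id}-R_n$ is $\beta_n$-Lipschitz continuous on $\operatorname{dom}R_n$. Let $S$ be a closed convex subset of $\mathcal H$, and let $Z$ be the set of all $x\in S$ such that, for every $n\in\mathbb N$, $T_nR_nx=x$ (in particular $x\in\operatorname{dom}R_n$). Suppose that $Z\neq\varnothing$. For every $n\in\mathbb N$, let $Q_n\colon\mathcal H\to\mathcal H$ be the projector onto a closed affine half-space containing $S$. Let $(a_n)_{n\in\mathbb N}$, $(b_n)_{n\in\mathbb N}$, $(c_n)_{n\in\mathbb N}$ be sequences in $\mathcal H$ such that $\sum_{n}\|a_n\|<+\infty$, $\sum_n\|b_n\|<+\infty$, and $\sum_n\|c_n\|<+\infty$. Let $\varepsilon\in\,]0,1[$, let $(\lambda_n)_{n\in\mathbb N}$ be a sequence in $[\varepsilon,1]$, and let $x_0\in\operatorname{dom}R_0$. Consider the routine which, for $n=0,1,2,\dots$, computes $$y_n=R_nx_n+a_n,\qquad q_n=T_ny_n+b_n,$$ stops if $q_n\notin\operatorname{dom}R_n$, and otherwise computes $$r_n=R_nq_n+c_n,\qquad z_n=x_n-y_n+r_n,\qquad x_{n+1}=x_n+\lambda_n(Q_nz_n-x_n),$$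 and stops if $x_{n+1}\notin\operatorname{dom}R_{n+1}$. Suppose that this routine never stops, so that it generates infinite sequences $(x_n)_{n\in\mathbb N}$ and $(z_n)_{n\in\mathbb N}$, and suppose that the following condition holds: for every $x\in\mathcal H$ and every subsequence $(x_{k_n})_{n\in\mathbb N}$ of $(x_n)_{n\in\mathbb N}$, if $x_{k_n}\rightharpoonup x$, $x_n-T_nR_nx_n\to0$, $z_n-x_n\to0$, and $z_n-Q_nz_n\to0$, then $x\in Z$. Then $(x_n)_{n\in\mathbb N}$ converges weakly to a point in $Z$.
   Context: $\operatorname{Id}$ is the identity operator, $\langle\cdot\mid\cdot\rangle$ and $\|\cdot\|$ are the scalar product and norm of $\mathcal H$, and $\rightharpoonup$ and $\to$ denote weak and strong convergence. Let $R\colon\operatorname{dom}R\subset\mathcal H\to\mathcal H$ be a single-valued operator. - $R$ is $\chi$-Lipschitz continuous ($\chi\in\,]0,+\infty[$) if $\|Rx-Ry\|\le\chi\|x-y\|$ for all $x,y\in\operatorname{dom}R$. - $R$ is pseudo contractive if $\|Rx-Ry\|^2\le\|x-y\|^2+\|(\operatorname{Id}-R)x-(\operatorname{Id}-R)y\|^2$ for all $x,y\in\operatorname{dom}R$. - $R$ is firmly nonexpansive if $\|Rx-Ry\|^2\le\|x-y\|^2-\|(\operatorname{Id}-R)x-(\operatorname{Id}-R)y\|^2$ for all $x,y\in\operatorname{dom}R$. *)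

theory Defs
  imports "HOL-Analysis.Analysis"
begin

definition weakly_tendsto :: "(nat \<Rightarrow> 'a::real_inner) \<Rightarrow> 'a \<Rightarrow> bool"
  where "weakly_tendsto x l \<longleftrightarrow> (\<forall>u. (\<lambda>n. x n \<bullet> u) \<longlonglongrightarrow> l \<bullet> u)"

(* An operator with domain D is modelled by a total function whose values outside D are irrelevant. *)

definition pseudo_contractive_on :: "'a::real_inner set \<Rightarrow> ('a \<Rightarrow> 'a) \<Rightarrow> bool"
  where "pseudo_contractive_on D R \<longleftrightarrow>
    (\<forall>x\<in>D. \<forall>y\<in>D. (norm (R x - R y))\<^sup>2
        \<le> (norm (x - y))\<^sup>2 + (norm ((x - R x) - (y - R y)))\<^sup>2)"

definition firmly_nonexpansive_on :: "'a::real_inner set \<Rightarrow> ('a \<Rightarrow> 'a) \<Rightarrow> bool"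
  where "firmly_nonexpansive_on D R \<longleftrightarrow>
    (\<forall>x\<in>D. \<forall>y\<in>D. (norm (R x - R y))\<^sup>2
        \<le> (norm (x - y))\<^sup>2 - (norm ((x - R x) - (y - R y)))\<^sup>2)"

definition closed_half_space :: "'a::real_inner set \<Rightarrow> bool"
  where "closed_half_space H \<longleftrightarrow> (\<exists>u \<eta>. u \<noteq> 0 \<and> H = {x. u \<bullet> x \<le> \<eta>})"

(* The library's closest_point is restricted to the class heine_borel, i.e. to finite dimension.
   For nonempty closed convex C in a Hilbert space this predicate determines P uniquely. *)
definition is_projector_onto :: "('a::real_inner \<Rightarrow> 'a) \<Rightarrow> 'a set \<Rightarrow> bool"
  where "is_projector_onto P C \<longleftrightarrow> (\<forall>x. P x \<in> C \<and> (\<forall>y\<in>C. dist x (P x) \<le> dist x y))"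

end

theory Submission
  imports Defs "HOL-Library.Diagonal_Subsequence"
begin

text \<open>
  Write \<open>B\<^sub>n = Id - R\<^sub>n\<close>. Pseudo contractivity of \<open>R\<^sub>n\<close> says exactly that \<open>B\<^sub>n\<close> is monotone, and
  \<open>T\<^sub>n (R\<^sub>n p) = p\<close> reads \<open>p = T\<^sub>n (p - B\<^sub>n p)\<close>, the optimality condition of a
  monotone inclusion. One pass of the routine is therefore a forward-backward-forward splitting
  step \<open>x, q = T (x - B x), w = q + B x - B q\<close>, spoiled by the errors \<open>a, b, c\<close>, followed by
  the projection \<open>Q\<^sub>n\<close> onto a half-space that contains every \<open>p \<in> Z\<close>, and by a relaxation.

  Without errors, adding the inequality of firm nonexpansiveness of \<open>T\<close> at \<open>x - B x, p - B p\<close>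
  and that of monotonicity of \<open>B\<close> at \<open>q, p\<close> gives
  \<open>\<parallel>w - p\<parallel>\<^sup>2 \<le> \<parallel>x - p\<parallel>\<^sup>2 - (1 - \<beta>\<^sup>2) \<parallel>x - q\<parallel>\<^sup>2\<close>. The exact backward point \<open>T (R x)\<close> need not lie
  in the domain of \<open>R\<close>, so the perturbed routine cannot be compared with an exact one; the errors
  are instead carried through the inequality itself. With \<open>e = \<parallel>a\<parallel> + \<parallel>b\<parallel> + \<parallel>c\<parallel>\<close> they only
  replace \<open>\<parallel>x - p\<parallel>\<close> on the right by \<open>\<parallel>x - p\<parallel> + 7 e\<close> once the projection and the relaxation are taken
  into account (\<open>forward_backward_forward_step\<close>, \<open>relaxed_projected_step\<close>).

  Summability of \<open>e\<close> then makes \<open>\<parallel>x\<^sub>n - p\<parallel>\<close> converge for every \<open>p \<in> Z\<close>, so the quantity that is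
  subtracted in the estimate tends to zero. This gives \<open>x\<^sub>n - q\<^sub>n \<longlonglongrightarrow> 0\<close> and
  \<open>z\<^sub>n - Q\<^sub>n z\<^sub>n \<longlonglongrightarrow> 0\<close>, hence also \<open>z\<^sub>n - x\<^sub>n \<longlonglongrightarrow> 0\<close> and
  \<open>x\<^sub>n - T\<^sub>n (R\<^sub>n x\<^sub>n) \<longlonglongrightarrow> 0\<close>, and by hypothesis all weak cluster points belong to \<open>Z\<close>.
  Opial's argument (\<open>opial_weak_convergence\<close>) concludes. It rests on weak sequential compactness of
  bounded sequences (\<open>bounded_imp_weakly_convergent_subsequence\<close>), which is obtained from one
  geometric fact about nested closed convex sets,
  \<open>decseq_closed_convex_Inter_nearest\<close>, in the place of the Riesz representation theorem.
\<close>

section \<open>Weak sequential compactness in Hilbert spaces\<close>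

text \<open>
  Points of \<open>C n\<close> that are nearly closest to \<open>a\<close> form a Cauchy sequence by the parallelogram law:
  the midpoint of two of them lies in a common \<open>C N\<close>, so it cannot be much closer to \<open>a\<close> than they
  are. For a constant sequence this is the projection theorem; for the closed convex hulls of the
  tails of a sequence it produces the candidate for a weak limit.
\<close>

lemma decseq_closed_convex_Inter_nearest:
  fixes C :: "nat \<Rightarrow> 'a::{real_inner,complete_space} set"
  assumes dec: "decseq C"
    and C: "\<And>n. closed (C n)" "\<And>n. convex (C n)" "\<And>n. C n \<noteq> {}"
    and bdd: "\<And>n. infdist a (C n) \<le> B"
  obtains l where "\<And>n. l \<in> C n" and "(\<lambda>n. infdist a (C n)) \<longlonglongrightarrow> dist a l"
proof -
  define d where "d = (\<lambda>n. infdist a (C n))"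
  have "incseq d"
    using dec C(3) by (auto simp: d_def incseq_def decseq_def intro!: infdist_mono)
  moreover have "Bseq d"
    using bdd by (intro BseqI'[of _ B]) (auto simp: d_def infdist_nonneg)
  ultimately obtain D where D: "d \<longlonglongrightarrow> D" "\<And>n. d n \<le> D"
    using incseq_convergent[of d B] bdd by (auto simp: d_def)
  have "\<exists>p\<in>C n. dist a p < d n + 1 / real (Suc n)" for n
  proof -
    have "Inf (dist a ` C n) < d n + 1 / real (Suc n)"
      using infdist_notempty[OF C(3)[of n], of a] by (simp add: d_def)
    then show ?thesis
      using cInf_lessD[of "dist a ` C n"] C(3)[of n] by auto
  qed
  then obtain p where p: "\<And>n. p n \<in> C n" "\<And>n. dist a (p n) < d n + 1 / real (Suc n)"
    by metis
  define g where "g = (\<lambda>n. 4 * ((D + 1 / real (Suc n))\<^sup>2 - (d n)\<^sup>2))"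
  have "g \<longlonglongrightarrow> 4 * ((D + 0)\<^sup>2 - D\<^sup>2)"
    unfolding g_def
    by (intro tendsto_intros D(1) LIMSEQ_Suc[OF lim_1_over_n])
  then have g: "g \<longlonglongrightarrow> 0" by simp
  have est: "(dist (p i) (p j))\<^sup>2 \<le> g N" if ij: "N \<le> i" "N \<le> j" for N i j
  proof -
    have in_N: "p k \<in> C N" if "N \<le> k" for k
      using that p(1)[of k] dec by (auto simp: decseq_def)
    have near: "dist a (p k) \<le> D + 1 / real (Suc N)" if "N \<le> k" for k
    proof -
      have "1 / real (Suc k) \<le> 1 / real (Suc N)" using that by (simp add: frac_le)
      with p(2)[of k] D(2)[of k] show ?thesis by linarith
    qed
    have sq: "(norm (a - p k))\<^sup>2 \<le> (D + 1 / real (Suc N))\<^sup>2" if "N \<le> k" for k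
      using near[OF that] by (intro power_mono) (auto simp: dist_norm)
    have "(1/2) *\<^sub>R p i + (1/2) *\<^sub>R p j \<in> C N"
      using C(2)[of N] in_N[OF ij(1)] in_N[OF ij(2)] by (auto simp: convex_def)
    then have "d N \<le> norm (a - ((1/2) *\<^sub>R p i + (1/2) *\<^sub>R p j))"
      unfolding d_def dist_norm[symmetric] by (rule infdist_le)
    then have mid: "(d N)\<^sup>2 \<le> (norm (a - ((1/2) *\<^sub>R p i + (1/2) *\<^sub>R p j)))\<^sup>2"
      by (intro power_mono) (auto simp: d_def infdist_nonneg)
    \<comment> \<open>the parallelogram law for \<open>a - p i\<close> and \<open>a - p j\<close>\<close>
    have "(norm (p i - p j))\<^sup>2 = 2 * (norm (a - p i))\<^sup>2 + 2 * (norm (a - p j))\<^sup>2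
            - 4 * (norm (a - ((1/2) *\<^sub>R p i + (1/2) *\<^sub>R p j)))\<^sup>2"
      unfolding power2_norm_eq_inner by (simp add: algebra_simps inner_commute)
    then show ?thesis
      using mid sq[OF ij(1)] sq[OF ij(2)] by (simp add: g_def dist_norm)
  qed
  have "Cauchy p"
  proof (rule metric_CauchyI)
    fix e :: real assume e: "0 < e"
    then obtain N where N: "g N < e\<^sup>2"
      using order_tendstoD(2)[OF g, of "e\<^sup>2"] by (auto simp: eventually_sequentially)
    have "dist (p i) (p j) < e" if "i \<ge> N" "j \<ge> N" for i j
      using est[OF that] N e by (meson le_less_trans less_imp_le power2_less_imp_less)
    then show "\<exists>M. \<forall>m\<ge>M. \<forall>n\<ge>M. dist (p m) (p n) < e" by blast
  qed
  then obtain l where l: "p \<longlonglongrightarrow> l"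
    using Cauchy_convergent_iff convergent_def by blast
  have "l \<in> C n" for n
  proof (rule Lim_in_closed_set[OF C(1) _ _ l])
    show "eventually (\<lambda>k. p k \<in> C n) sequentially"
      using p(1) dec unfolding eventually_sequentially decseq_def by blast
  qed simp
  moreover have "d \<longlonglongrightarrow> dist a l"
  proof -
    have "(\<lambda>n. d n + 1 / real (Suc n)) \<longlonglongrightarrow> D + 0"
      by (intro tendsto_intros D(1) LIMSEQ_Suc[OF lim_1_over_n])
    then have "(\<lambda>n. dist a (p n)) \<longlonglongrightarrow> D"
      using D(1) p infdist_le[OF p(1)]
      by (intro tendsto_sandwich[of d "\<lambda>n. dist a (p n)" _ "\<lambda>n. d n + 1 / real (Suc n)"])
        (auto simp: d_def less_imp_le)
    moreover have "(\<lambda>n. dist a (p n)) \<longlonglongrightarrow> dist a l"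
      by (intro tendsto_intros l)
    ultimately show ?thesis
      using D(1) LIMSEQ_unique by blast
  qed
  ultimately show thesis using that unfolding d_def by blast
qed

lemma closed_subspace_orthogonal_projection:
  fixes V :: "'a::{real_inner,complete_space} set"
  assumes V: "closed V" "subspace V"
  obtains v where "v \<in> V" and "\<And>w. w \<in> V \<Longrightarrow> w \<bullet> (u - v) = 0"
proof -
  have ne: "V \<noteq> {}" and cv: "convex V"
    using V(2) subspace_0 subspace_imp_convex by blast+
  have "decseq (\<lambda>_::nat. V)" by (simp add: decseq_def)
  then obtain v where v: "v \<in> V" "(\<lambda>_::nat. infdist u V) \<longlonglongrightarrow> dist u v"
    using decseq_closed_convex_Inter_nearest[of "\<lambda>_. V" u "infdist u V"] V(1) cv ne by blast
  then have "infdist u V = dist u v"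
    using LIMSEQ_unique tendsto_const by blast
  then have near: "\<forall>w\<in>V. dist u v \<le> dist u w"
    using infdist_le by metis
  have le: "(u - v) \<bullet> w \<le> 0" if "w \<in> V" for w
    using any_closest_point_dot[OF cv V(1) v(1) subspace_add[OF V(2) v(1) that] near] by simp
  have "w \<bullet> (u - v) = 0" if "w \<in> V" for w
    using le[OF that] le[OF subspace_neg[OF V(2) that]] by (simp add: inner_commute)
  with v(1) show thesis using that by blast
qed

text \<open>
  The limit has to lie in the closed convex hull of every tail. Conversely, any such point works:
  if the numbers \<open>x n \<bullet> u\<close> of a tail lie in a small interval, the tail lies in the corresponding
  closed convex slab, and so does its closed convex hull.
\<close>

lemma weakly_tendsto_if_inner_convergent:
  fixes x :: "nat \<Rightarrow> 'a::{real_inner,complete_space}"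
  assumes bdd: "\<And>n. norm (x n) \<le> B" and conv: "\<And>u. convergent (\<lambda>n. x n \<bullet> u)"
  obtains l where "weakly_tendsto x l"
proof -
  define C where "C n = closure (convex hull (x ` {n..}))" for n
  have x_C: "x n \<in> C n" for n
    unfolding C_def by (meson atLeast_iff closure_subset hull_inc image_eqI order_refl subsetD)
  have "decseq C"
    unfolding decseq_def C_def by (intro allI impI closure_mono hull_mono image_mono) auto
  moreover have "closed (C n)" "convex (C n)" "C n \<noteq> {}" for n
    using x_C[of n] by (auto simp: C_def intro: convex_closure)
  moreover have "infdist 0 (C n) \<le> B" for n
    by (rule infdist_le2[OF x_C]) (simp add: bdd)
  ultimately obtain l where l: "\<And>n. l \<in> C n"
    using decseq_closed_convex_Inter_nearest[of C 0 B] by blast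
  have "(\<lambda>n. x n \<bullet> u) \<longlonglongrightarrow> l \<bullet> u" for u
  proof -
    obtain L where L: "(\<lambda>n. x n \<bullet> u) \<longlonglongrightarrow> L"
      using conv[of u] by (auto simp: convergent_def)
    have "\<bar>l \<bullet> u - L\<bar> \<le> e" if e: "0 < e" for e
    proof -
      obtain N where N: "\<And>n. n \<ge> N \<Longrightarrow> \<bar>x n \<bullet> u - L\<bar> < e"
        using LIMSEQ_D[OF L e] by auto
      let ?K = "{w. u \<bullet> w \<ge> L - e} \<inter> {w. u \<bullet> w \<le> L + e}"
      have "x ` {N..} \<subseteq> ?K"
        using N by (force simp: inner_commute abs_less_iff)
      moreover have "convex ?K" "closed ?K"
        by (intro convex_Int convex_halfspace_ge convex_halfspace_le closed_Int
            closed_halfspace_ge closed_halfspace_le)+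
      ultimately have "C N \<subseteq> ?K"
        unfolding C_def by (intro closure_minimal hull_minimal)
      with l[of N] show ?thesis by (auto simp: inner_commute abs_le_iff)
    qed
    then have "l \<bullet> u = L"
      by (metis abs_le_zero_iff eq_iff_diff_eq_0 dense_ge)
    with L show ?thesis by simp
  qed
  then show thesis using that by (auto simp: weakly_tendsto_def)
qed

text \<open>
  A diagonal argument needs countably many functionals, and the space may be nonseparable. The
  elements \<open>x m\<close> themselves suffice as test vectors: the vectors against which the subsequence
  converges form a closed subspace \<open>V\<close> containing all \<open>x m\<close>, and a vector orthogonal to \<open>V\<close> is
  tested to zero.
\<close>

lemma bounded_imp_weakly_convergent_subsequence:
  fixes x :: "nat \<Rightarrow> 'a::{real_inner,complete_space}"
  assumes bdd: "\<And>n. norm (x n) \<le> B"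
  obtains k l where "strict_mono k" and "weakly_tendsto (\<lambda>n. x (k n)) l"
proof -
  interpret subseqs "\<lambda>m s. convergent (\<lambda>n. x (s n) \<bullet> x m)"
  proof
    fix m and s :: "nat \<Rightarrow> nat"
    have "bounded (range (\<lambda>n. x (s n) \<bullet> x m))"
    proof (rule boundedI)
      fix t assume "t \<in> range (\<lambda>n. x (s n) \<bullet> x m)"
      then obtain n where "t = x (s n) \<bullet> x m" by blast
      then have "norm t \<le> norm (x (s n)) * norm (x m)"
        by (simp add: Cauchy_Schwarz_ineq2)
      also have "\<dots> \<le> B * norm (x m)" using bdd by (intro mult_right_mono) auto
      finally show "norm t \<le> B * norm (x m)" .
    qed
    then obtain L r where "strict_mono r" "((\<lambda>n. x (s n) \<bullet> x m) \<circ> r) \<longlonglongrightarrow> L"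
      using bounded_imp_convergent_subsequence by blast
    then show "\<exists>r. strict_mono r \<and> convergent (\<lambda>n. x ((s \<circ> r) n) \<bullet> x m)"
      by (auto simp: convergent_def o_def)
  qed
  define k where "k = diagseq"
  have k: "strict_mono k" by (simp add: k_def subseq_diagseq)
  have conv_x: "convergent (\<lambda>n. x (k n) \<bullet> x m)" for m
  proof -
    have "convergent (\<lambda>n. x ((s \<circ> r) n) \<bullet> x j)"
      if "strict_mono r" "convergent (\<lambda>n. x (s n) \<bullet> x j)" for r s j
      using that convergent_subseq_convergent[of "\<lambda>n. x (s n) \<bullet> x j" r] by (simp add: o_def)
    then have "convergent (\<lambda>n. x ((diagseq \<circ> (+) (Suc m)) n) \<bullet> x m)"
      by (rule diagseq_holds)
    then have "convergent (\<lambda>n. x (k (n + Suc m)) \<bullet> x m)"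
      by (simp add: k_def o_def add.commute)
    then show ?thesis
      using convergent_ignore_initial_segment[of "\<lambda>n. x (k n) \<bullet> x m"] by blast
  qed
  define V where "V = {u. convergent (\<lambda>n. x (k n) \<bullet> u)}"
  have V: "subspace V"
    unfolding subspace_def V_def
    by (auto simp: inner_add_right convergent_const
        intro: convergent_add convergent_mult[OF convergent_const])
  have "closed V"
    unfolding closed_sequential_limits
  proof (intro allI impI, elim conjE)
    fix v u assume v: "\<forall>j. v j \<in> V" and vu: "v \<longlonglongrightarrow> u"
    have close: "\<bar>x n \<bullet> u - x n \<bullet> v j\<bar> \<le> B * norm (v j - u)" for n j
    proof -
      have "\<bar>x n \<bullet> u - x n \<bullet> v j\<bar> \<le> norm (x n) * norm (u - v j)"
        by (metis Cauchy_Schwarz_ineq2 inner_diff_right)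
      also have "\<dots> \<le> B * norm (v j - u)"
        by (simp add: bdd mult_right_mono norm_minus_commute)
      finally show ?thesis .
    qed
    have "Cauchy (\<lambda>n. x (k n) \<bullet> u)"
    proof (rule metric_CauchyI)
      fix e :: real assume e: "0 < e"
      have "(\<lambda>j. B * norm (v j - u)) \<longlonglongrightarrow> B * 0"
        by (intro tendsto_intros tendsto_norm_zero LIM_zero vu)
      then have "eventually (\<lambda>j. B * norm (v j - u) < e / 3) sequentially"
        using e by (intro order_tendstoD(2)[of _ 0]) auto
      then obtain j where j: "B * norm (v j - u) < e / 3"
        by (auto simp: eventually_sequentially)
      have "Cauchy (\<lambda>n. x (k n) \<bullet> v j)"
        using v by (simp add: V_def Cauchy_convergent_iff)
      then obtain N where N: "dist (x (k m) \<bullet> v j) (x (k n) \<bullet> v j) < e / 3"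
        if "m \<ge> N" "n \<ge> N" for m n
        using e metric_CauchyD[of "\<lambda>n. x (k n) \<bullet> v j" "e / 3"] by auto
      have "dist (x (k m) \<bullet> u) (x (k n) \<bullet> u) < e" if "m \<ge> N" "n \<ge> N" for m n
        using N[OF that] close[of "k m" j] close[of "k n" j] j
        unfolding dist_real_def by linarith
      then show "\<exists>M. \<forall>m\<ge>M. \<forall>n\<ge>M. dist (x (k m) \<bullet> u) (x (k n) \<bullet> u) < e" by blast
    qed
    then show "u \<in> V" by (simp add: V_def Cauchy_convergent_iff)
  qed
  have "u \<in> V" for u
  proof -
    obtain v where v: "v \<in> V" "\<And>w. w \<in> V \<Longrightarrow> w \<bullet> (u - v) = 0"
      using closed_subspace_orthogonal_projection[OF \<open>closed V\<close> V] by blast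
    have "x (k n) \<bullet> u = x (k n) \<bullet> v" for n
      using v(2)[of "x (k n)"] conv_x by (simp add: V_def inner_diff_right)
    with v(1) show ?thesis by (simp add: V_def)
  qed
  then obtain l where "weakly_tendsto (\<lambda>n. x (k n)) l"
    using weakly_tendsto_if_inner_convergent[of "\<lambda>n. x (k n)" B] bdd by (auto simp: V_def)
  with k show thesis using that by blast
qed

text \<open>
  The difference of \<open>\<parallel>x n - p'\<parallel>\<^sup>2\<close> and \<open>\<parallel>x n - p\<parallel>\<^sup>2\<close> is affine in \<open>x n\<close>, so \<open>x n \<bullet> (p - p')\<close>
  converges for \<open>p, p' \<in> Z\<close>. If both are weak cluster points, its limit is \<open>p \<bullet> (p - p')\<close> as well
  as \<open>p' \<bullet> (p - p')\<close>, which forces \<open>p = p'\<close>; a bounded sequence with only one weak cluster point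
  converges weakly.
\<close>

lemma opial_weak_convergence:
  fixes x :: "nat \<Rightarrow> 'a::{real_inner,complete_space}"
  assumes "Z \<noteq> {}"
    and fejer: "\<And>p. p \<in> Z \<Longrightarrow> convergent (\<lambda>n. norm (x n - p))"
    and cluster: "\<And>k p. strict_mono k \<Longrightarrow> weakly_tendsto (\<lambda>n. x (k n)) p \<Longrightarrow> p \<in> Z"
  shows "\<exists>p\<in>Z. weakly_tendsto x p"
proof -
  obtain p0 where "p0 \<in> Z" using assms(1) by blast
  then have "Bseq (\<lambda>n. norm (x n - p0))"
    by (intro convergent_imp_Bseq fejer)
  then obtain M where "\<And>n. norm (x n - p0) \<le> M" by (auto simp: Bseq_def)
  then have bdd: "norm (x n) \<le> M + norm p0" for n
    using norm_triangle_sub[of "x n" p0] by (simp add: add.commute order_trans)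
  have unique: "p = p'"
    if k: "strict_mono k" "weakly_tendsto (\<lambda>n. x (k n)) p"
      and k': "strict_mono k'" "weakly_tendsto (\<lambda>n. x (k' n)) p'" for k k' p p'
  proof -
    have "convergent (\<lambda>n. norm (x n - p))" "convergent (\<lambda>n. norm (x n - p'))"
      using fejer cluster k k' by blast+
    then obtain L L' where L: "(\<lambda>n. norm (x n - p)) \<longlonglongrightarrow> L" "(\<lambda>n. norm (x n - p')) \<longlonglongrightarrow> L'"
      by (auto simp: convergent_def)
    have expand: "x n \<bullet> (p - p') = ((norm (x n - p'))\<^sup>2 - (norm (x n - p))\<^sup>2 + (p \<bullet> p - p' \<bullet> p')) / 2" for n
      unfolding power2_norm_eq_inner by (simp add: algebra_simps inner_commute)
    have lim: "(\<lambda>n. x n \<bullet> (p - p')) \<longlonglongrightarrow> (L'\<^sup>2 - L\<^sup>2 + (p \<bullet> p - p' \<bullet> p')) / 2"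
      unfolding expand using L by (intro tendsto_intros) simp_all
    have "p \<bullet> (p - p') = (L'\<^sup>2 - L\<^sup>2 + (p \<bullet> p - p' \<bullet> p')) / 2"
      using LIMSEQ_subseq_LIMSEQ[OF lim k(1)] k(2) LIMSEQ_unique
      unfolding weakly_tendsto_def o_def by blast
    moreover have "p' \<bullet> (p - p') = (L'\<^sup>2 - L\<^sup>2 + (p \<bullet> p - p' \<bullet> p')) / 2"
      using LIMSEQ_subseq_LIMSEQ[OF lim k'(1)] k'(2) LIMSEQ_unique
      unfolding weakly_tendsto_def o_def by blast
    ultimately have "(p - p') \<bullet> (p - p') = 0" by (simp add: inner_diff_left)
    then show ?thesis by simp
  qed
  obtain k p where k: "strict_mono k" "weakly_tendsto (\<lambda>n. x (k n)) p"
    by (rule bounded_imp_weakly_convergent_subsequence[OF bdd])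
  have "(\<lambda>n. x n \<bullet> u) \<longlonglongrightarrow> p \<bullet> u" for u
  proof (rule ccontr)
    assume "\<not> ?thesis"
    then obtain e where e: "0 < e" "\<exists>\<^sub>F n in sequentially. \<not> dist (x n \<bullet> u) (p \<bullet> u) < e"
      unfolding tendsto_iff not_eventually[symmetric] by blast
    define s where "s = enumerate {n. \<not> dist (x n \<bullet> u) (p \<bullet> u) < e}"
    have inf: "infinite {n. \<not> dist (x n \<bullet> u) (p \<bullet> u) < e}"
      using e(2) unfolding cofinite_eq_sequentially[symmetric] frequently_cofinite .
    have s: "strict_mono s" "\<not> dist (x (s n) \<bullet> u) (p \<bullet> u) < e" for n
      using strict_mono_enumerate[OF inf] enumerate_in_set[OF inf, of n]
      unfolding s_def mem_Collect_eq by blast+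
    obtain k' p' where k': "strict_mono k'" "weakly_tendsto (\<lambda>n. x (s (k' n))) p'"
      by (rule bounded_imp_weakly_convergent_subsequence[OF bdd])
    have "p = p'"
    proof (rule unique[OF k])
      show "strict_mono (\<lambda>n. s (k' n))"
        using strict_mono_o[OF s(1) k'(1)] by (simp add: o_def)
    qed (rule k'(2))
    then have "(\<lambda>n. x (s (k' n)) \<bullet> u) \<longlonglongrightarrow> p \<bullet> u"
      using k'(2) by (simp add: weakly_tendsto_def)
    then have "eventually (\<lambda>n. dist (x (s (k' n)) \<bullet> u) (p \<bullet> u) < e) sequentially"
      using e(1) by (rule tendstoD)
    then show False
      using s(2) eventually_happens'[OF sequentially_bot] by blast
  qed
  then have "weakly_tendsto x p" by (simp add: weakly_tendsto_def)
  with cluster[OF k] show ?thesis by blast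
qed

section \<open>One step of the algorithm\<close>

lemma half_space_projector_pythagoras:
  assumes "is_projector_onto P H" and "closed_half_space H" and "p \<in> H"
  shows "(norm (P z - p))\<^sup>2 \<le> (norm (z - p))\<^sup>2 - (norm (z - P z))\<^sup>2"
proof -
  have "convex H" "closed H"
    using assms(2) by (auto simp: closed_half_space_def convex_halfspace_le closed_halfspace_le)
  then have "(z - P z) \<bullet> (p - P z) \<le> 0"
    using assms(1,3) by (intro any_closest_point_dot) (auto simp: is_projector_onto_def)
  then show ?thesis
    unfolding power2_norm_eq_inner by (simp add: algebra_simps inner_commute)
qed

lemma firmly_nonexpansive_on_inner:
  assumes "firmly_nonexpansive_on D T" "u \<in> D" "v \<in> D"
  shows "0 \<le> (T u - T v) \<bullet> ((u - T u) - (v - T v))"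
proof -
  have "(norm (T u - T v))\<^sup>2 \<le> (norm (u - v))\<^sup>2 - (norm ((u - T u) - (v - T v)))\<^sup>2"
    using assms by (auto simp: firmly_nonexpansive_on_def)
  then show ?thesis
    unfolding power2_norm_eq_inner by (simp add: algebra_simps inner_commute)
qed

lemma firmly_nonexpansive_on_norm_le:
  assumes "firmly_nonexpansive_on D T" "u \<in> D" "v \<in> D"
  shows "norm (T u - T v) \<le> norm (u - v)"
proof (rule power2_le_imp_le)
  have "(norm (T u - T v))\<^sup>2 \<le> (norm (u - v))\<^sup>2 - (norm ((u - T u) - (v - T v)))\<^sup>2"
    using assms by (auto simp: firmly_nonexpansive_on_def)
  then show "(norm (T u - T v))\<^sup>2 \<le> (norm (u - v))\<^sup>2"
    using zero_le_power2[of "norm ((u - T u) - (v - T v))"] by linarith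
qed simp

lemma pseudo_contractive_on_inner:
  assumes "pseudo_contractive_on D R" "u \<in> D" "v \<in> D"
  shows "0 \<le> (u - v) \<bullet> ((u - R u) - (v - R v))"
proof -
  have "(norm (R u - R v))\<^sup>2 \<le> (norm (u - v))\<^sup>2 + (norm ((u - R u) - (v - R v)))\<^sup>2"
    using assms by (auto simp: pseudo_contractive_on_def)
  then show ?thesis
    unfolding power2_norm_eq_inner by (simp add: algebra_simps inner_commute)
qed

text \<open>
  Write \<open>\<xi> = \<parallel>x - p\<parallel>\<close>. The inequality for the unperturbed iteration is an identity for
  \<open>\<parallel>w - p\<parallel>\<^sup>2\<close> from which two nonnegative inner products are dropped. Here the one coming from \<open>T\<close> is available only
  for \<open>t = q - b\<close> and the input \<open>R x + a\<close>, and correcting this costs \<open>(t - p) \<bullet> (a + b)\<close> and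
  \<open>b \<bullet> d\<close>. Nonexpansiveness of \<open>B\<close> and \<open>T\<close> bounds \<open>t - p\<close> and \<open>d\<close> linearly in \<open>\<xi>\<close> and \<open>e\<close>;
  the total correction is at most \<open>12 \<xi> e + 6 e\<^sup>2\<close>, which \<open>(\<xi> + 6 e)\<^sup>2\<close> absorbs.
\<close>

lemma forward_backward_forward_step:
  assumes T: "firmly_nonexpansive_on UNIV T" and R: "pseudo_contractive_on D R"
    and lip: "\<beta>-lipschitz_on D (\<lambda>u. u - R u)" and \<beta>: "\<beta> \<le> 1"
    and D: "x \<in> D" "q \<in> D" "p \<in> D" and p: "T (R p) = p"
    and q: "q = T (R x + a) + b"
    and e: "norm a + norm b \<le> e"
  shows "(norm (x - R x + R q - p))\<^sup>2 \<le> (norm (x - p) + 6 * e)\<^sup>2 - (1 - \<beta>\<^sup>2) * (norm (x - q))\<^sup>2"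
proof -
  define B where "B = (\<lambda>u. u - R u)"
  define \<xi> where "\<xi> = norm (x - p)"
  define w where "w = q + (B x - B q)"
  define d where "d = x - q - B x + B p"
  define t where "t = q - b"
  have \<beta>0: "0 \<le> \<beta>" and B: "norm (B u - B v) \<le> \<beta> * norm (u - v)" if "u \<in> D" "v \<in> D" for u v
    using lip that by (auto simp: lipschitz_on_def B_def dist_norm)
  have B1: "norm (B u - B v) \<le> norm (u - v)" if "u \<in> D" "v \<in> D" for u v
    using B[OF that] mult_right_mono[OF \<beta>, of "norm (u - v)"] by simp
  have e0: "0 \<le> e" "norm a \<le> e" "norm b \<le> e" "0 \<le> \<xi>"
    using e norm_ge_zero[of a] norm_ge_zero[of b] unfolding \<xi>_def by (linarith | simp)+
  have t: "t = T (R x + a)" by (simp add: t_def q)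
  have T_ineq: "0 \<le> (t - p) \<bullet> (d + a + b)"
    using firmly_nonexpansive_on_inner[OF T, of "R x + a" "R p"] p t
    by (simp add: t_def d_def B_def algebra_simps)
  have B_ineq: "0 \<le> (q - p) \<bullet> (B q - B p)"
    using pseudo_contractive_on_inner[OF R D(2,3)] by (simp add: B_def)
  have tp: "norm (t - p) \<le> 2 * \<xi> + e"
  proof -
    have "norm (t - p) \<le> norm (R x + a - R p)"
      using firmly_nonexpansive_on_norm_le[OF T, of "R x + a" "R p"] p t by simp
    also have "R x + a - R p = (x - p) - (B x - B p) + a" by (simp add: B_def)
    also have "norm \<dots> \<le> norm (x - p) + norm (B x - B p) + norm a"
      by (meson norm_triangle_ineq norm_triangle_ineq4 add_right_mono order_trans)
    also have "\<dots> \<le> 2 * \<xi> + e" using B1[OF D(1,3)] e0 by (simp add: \<xi>_def)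
    finally show ?thesis .
  qed
  have dn: "norm d \<le> 4 * \<xi> + 2 * e"
  proof -
    have "d = (x - p) - (t - p) - b - (B x - B p)" by (simp add: d_def t_def)
    also have "norm \<dots> \<le> norm (x - p) + norm (t - p) + norm b + norm (B x - B p)"
      by (meson norm_triangle_ineq4 add_right_mono order_trans)
    also have "\<dots> \<le> 4 * \<xi> + 2 * e" using B1[OF D(1,3)] e0 tp by (simp add: \<xi>_def)
    finally show ?thesis .
  qed
  \<comment> \<open>the sum of the inequalities for \<open>T\<close> and \<open>B\<close>, with the error terms\<close>
  have lower: "- ((2 * \<xi> + e) * e + e * (4 * \<xi> + 2 * e)) \<le> (q - p) \<bullet> (d + (B q - B p))"
  proof -
    have "(q - p) \<bullet> (d + (B q - B p))
        = (t - p) \<bullet> (d + a + b) - (t - p) \<bullet> (a + b) + b \<bullet> d + (q - p) \<bullet> (B q - B p)"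
      by (simp add: t_def algebra_simps)
    moreover have "(t - p) \<bullet> (a + b) \<le> (2 * \<xi> + e) * e"
      using norm_cauchy_schwarz[of "t - p" "a + b"] tp e0 norm_triangle_ineq[of a b] e
      by (meson mult_mono norm_ge_zero order_trans)
    moreover have "- (e * (4 * \<xi> + 2 * e)) \<le> b \<bullet> d"
    proof -
      have "\<bar>b \<bullet> d\<bar> \<le> e * (4 * \<xi> + 2 * e)"
        using Cauchy_Schwarz_ineq2[of b d] dn e0 by (meson mult_mono norm_ge_zero order_trans)
      then show ?thesis by linarith
    qed
    ultimately show ?thesis using T_ineq B_ineq by linarith
  qed
  have lip2: "(norm (B x - B q))\<^sup>2 \<le> \<beta>\<^sup>2 * (norm (x - q))\<^sup>2"
    using power_mono[OF B[OF D(1,2)], of 2] by (simp add: power_mult_distrib)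
  have "(norm (w - p))\<^sup>2 = \<xi>\<^sup>2 - (norm (x - q))\<^sup>2 + (norm (B x - B q))\<^sup>2
      - 2 * ((q - p) \<bullet> (d + (B q - B p)))"
    unfolding power2_norm_eq_inner w_def d_def \<xi>_def
    by (simp add: algebra_simps inner_commute)
  also have "\<dots> \<le> \<xi>\<^sup>2 - (1 - \<beta>\<^sup>2) * (norm (x - q))\<^sup>2
      + 2 * ((2 * \<xi> + e) * e + e * (4 * \<xi> + 2 * e))"
    using lower lip2 by (simp add: algebra_simps)
  also have "\<dots> \<le> (\<xi> + 6 * e)\<^sup>2 - (1 - \<beta>\<^sup>2) * (norm (x - q))\<^sup>2"
    using mult_nonneg_nonneg[OF e0(1,1)] by (simp add: power2_eq_square algebra_simps)
  finally show ?thesis by (simp add: w_def B_def \<xi>_def algebra_simps)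
qed

text \<open>
  The bound \<open>(\<xi> + \<delta> + e)\<^sup>2\<close> is a common bound for the two terms of the convex combination
  \<open>(1 - l) \<parallel>x - p\<parallel>\<^sup>2 + l \<parallel>Qz - p\<parallel>\<^sup>2\<close>, and only the second one carries the gain, which is why the
  gain is scaled by the lower bound \<open>\<epsilon>\<close> of the relaxation parameters.
\<close>

lemma relaxed_projected_step:
  fixes x w z p Qz :: "'a::real_inner"
  assumes w: "(norm (w - p))\<^sup>2 \<le> (\<xi> + \<delta>)\<^sup>2 - K" and K: "0 \<le> K"
    and z: "norm (z - w) \<le> e"
    and \<xi>: "\<xi> = norm (x - p)" and \<delta>: "0 \<le> \<delta>"
    and Q: "(norm (Qz - p))\<^sup>2 \<le> (norm (z - p))\<^sup>2 - (norm (z - Qz))\<^sup>2"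
    and l: "0 < \<epsilon>" "\<epsilon> \<le> l" "l \<le> 1"
  shows "(norm (x + l *\<^sub>R (Qz - x) - p))\<^sup>2
      \<le> (\<xi> + \<delta> + e)\<^sup>2 - \<epsilon> * (K + (norm (z - Qz))\<^sup>2)"
proof -
  define G where "G = K + (norm (z - Qz))\<^sup>2"
  have e: "0 \<le> e" using z norm_ge_zero order_trans by blast
  have \<xi>0: "0 \<le> \<xi>" by (simp add: \<xi>)
  have G: "0 \<le> G" using K by (simp add: G_def)
  have w': "norm (w - p) \<le> \<xi> + \<delta>"
    by (rule power2_le_imp_le) (use w K \<xi>0 \<delta> in linarith)+
  have "norm (z - p) \<le> norm (z - w) + norm (w - p)"
    by (metis diff_add_cancel add_diff_eq norm_triangle_ineq)
  then have "(norm (z - p))\<^sup>2 \<le> (norm (w - p) + e)\<^sup>2" using z by (intro power_mono) auto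
  also have "\<dots> = (norm (w - p))\<^sup>2 + 2 * e * norm (w - p) + e\<^sup>2" by (simp add: power2_sum)
  also have "\<dots> \<le> (\<xi> + \<delta>)\<^sup>2 - K + 2 * e * (\<xi> + \<delta>) + e\<^sup>2"
    using w mult_left_mono[OF w', of "2 * e"] e by simp
  finally have "(norm (z - p))\<^sup>2 \<le> (\<xi> + \<delta> + e)\<^sup>2 - K" by (simp add: power2_sum algebra_simps)
  with Q have Q': "(norm (Qz - p))\<^sup>2 \<le> (\<xi> + \<delta> + e)\<^sup>2 - G" by (simp add: G_def)
  have "(norm (x + l *\<^sub>R (Qz - x) - p))\<^sup>2
      = (1 - l) * \<xi>\<^sup>2 + l * (norm (Qz - p))\<^sup>2 - l * (1 - l) * (norm (Qz - x))\<^sup>2"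
  proof -
    have "(norm ((1 - l) *\<^sub>R u + l *\<^sub>R v))\<^sup>2
        = (1 - l) * (norm u)\<^sup>2 + l * (norm v)\<^sup>2 - l * (1 - l) * (norm (v - u))\<^sup>2" for u v :: 'a
      unfolding power2_norm_eq_inner by (simp add: algebra_simps inner_commute)
    from this[of "x - p" "Qz - p"] show ?thesis by (simp add: \<xi> algebra_simps)
  qed
  also have "\<dots> \<le> (1 - l) * \<xi>\<^sup>2 + l * (norm (Qz - p))\<^sup>2" using l by simp
  also have "\<dots> \<le> (1 - l) * (\<xi> + \<delta> + e)\<^sup>2 + l * ((\<xi> + \<delta> + e)\<^sup>2 - G)"
    using Q' l \<xi>0 \<delta> e by (intro add_mono mult_left_mono power_mono) auto
  also have "\<dots> = (\<xi> + \<delta> + e)\<^sup>2 - l * G" by (simp add: algebra_simps)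
  also have "\<dots> \<le> (\<xi> + \<delta> + e)\<^sup>2 - \<epsilon> * G" using mult_right_mono[OF l(2) G] by simp
  finally show ?thesis by (simp add: G_def)
qed

text \<open>
  Subtracting the partial sums of \<open>e\<close> from \<open>\<xi>\<close> leaves a decreasing sequence, bounded below because
  \<open>\<xi>\<close> is nonnegative and the partial sums are bounded.
\<close>

lemma quasi_decreasing_imp_convergent:
  fixes \<xi> e :: "nat \<Rightarrow> real"
  assumes "\<And>n. 0 \<le> \<xi> n" and "\<And>n. \<xi> (Suc n) \<le> \<xi> n + e n" and "summable e"
  shows "convergent \<xi>"
proof -
  define s where "s n = (\<Sum>i<n. e i)" for n
  have s: "convergent s"
    using assms(3) by (simp add: s_def[abs_def] summable_iff_convergent)
  then obtain M where M: "\<And>n. s n \<le> M"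
    using convergent_imp_Bseq Bseq_def by (metis abs_le_D1 real_norm_def)
  have "decseq (\<lambda>n. \<xi> n - s n)"
    using assms(2) by (simp add: decseq_Suc_iff s_def algebra_simps)
  moreover have "\<forall>n. - M \<le> \<xi> n - s n"
    using M assms(1) by (smt (verit))
  ultimately obtain L where "(\<lambda>n. \<xi> n - s n) \<longlonglongrightarrow> L"
    by (rule decseq_convergent)
  then have "convergent (\<lambda>n. \<xi> n - s n)" by (rule convergentI)
  from convergent_add[OF this s] show ?thesis by simp
qed

section \<open>Weak convergence of the iterates\<close>

theorem theorem2p2:
  fixes \<epsilon>\<^sub>0 \<epsilon> :: real
    and \<beta> lam :: "nat \<Rightarrow> real"
    and T R Q :: "nat \<Rightarrow> 'a::{real_inner,complete_space} \<Rightarrow> 'a"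
    and domR :: "nat \<Rightarrow> 'a set"
    and S Z :: "'a set"
    and a b c x y q r z :: "nat \<Rightarrow> 'a"
  assumes "0 < \<epsilon>\<^sub>0" and "\<epsilon>\<^sub>0 < 1"
    and "\<And>n. 0 < \<beta> n \<and> \<beta> n \<le> 1 - \<epsilon>\<^sub>0"
    and "\<And>n. firmly_nonexpansive_on UNIV (T n)"
    and "\<And>n. pseudo_contractive_on (domR n) (R n)"
    and "\<And>n. (\<beta> n)-lipschitz_on (domR n) (\<lambda>u. u - R n u)"
    and "closed S" and "convex S"
    and Z: "Z = {u \<in> S. \<forall>n. u \<in> domR n \<and> T n (R n u) = u}"
    and "Z \<noteq> {}"
    and "\<And>n. \<exists>H. closed_half_space H \<and> S \<subseteq> H \<and> is_projector_onto (Q n) H"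
    and "summable (\<lambda>n. norm (a n))"
    and "summable (\<lambda>n. norm (b n))"
    and "summable (\<lambda>n. norm (c n))"
    and "0 < \<epsilon>" and "\<epsilon> < 1"
    and "\<And>n. \<epsilon> \<le> lam n \<and> lam n \<le> 1"
    and "x 0 \<in> domR 0"
    and "\<And>n. y n = R n (x n) + a n"
    and "\<And>n. q n = T n (y n) + b n"
    and "\<And>n. q n \<in> domR n"
    and "\<And>n. r n = R n (q n) + c n"
    and "\<And>n. z n = x n - y n + r n"
    and "\<And>n. x (Suc n) = x n + lam n *\<^sub>R (Q n (z n) - x n)"
    and "\<And>n. x (Suc n) \<in> domR (Suc n)"
    and "\<And>u k. strict_mono k \<Longrightarrow> weakly_tendsto (\<lambda>n. x (k n)) u \<Longrightarrow>
           (\<lambda>n. x n - T n (R n (x n))) \<longlonglongrightarrow> 0 \<Longrightarrow>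
           (\<lambda>n. z n - x n) \<longlonglongrightarrow> 0 \<Longrightarrow>
           (\<lambda>n. z n - Q n (z n)) \<longlonglongrightarrow> 0 \<Longrightarrow> u \<in> Z"
  shows "\<exists>u\<in>Z. weakly_tendsto x u"
proof -
  define e where "e n = norm (a n) + norm (b n) + norm (c n)" for n
  define \<kappa> where "\<kappa> = 1 - (1 - \<epsilon>\<^sub>0)\<^sup>2"
  define w where "w n = x n - R n (x n) + R n (q n)" for n
  note T = assms(4) and R = assms(5) and lip = assms(6) and lam = assms(17)
    and y = assms(19) and q = assms(20) and qD = assms(21) and r = assms(22) and z = assms(23)
    and step = assms(24)
  have xD: "x n \<in> domR n" for n
    using assms(18,25) by (cases n) auto
  have e0: "0 \<le> e n" for n by (simp add: e_def)
  have e_sum: "summable e"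
    unfolding e_def[abs_def] by (intro summable_add assms(12-14))
  have \<kappa>: "0 < \<kappa>"
  proof -
    have "(1 - \<epsilon>\<^sub>0)\<^sup>2 < 1\<^sup>2"
      using assms(1,2) by (intro power_strict_mono) auto
    then show ?thesis by (simp add: \<kappa>_def)
  qed
  have \<kappa>_le: "\<kappa> \<le> 1 - (\<beta> n)\<^sup>2" for n
    using assms(3)[of n] by (simp add: \<kappa>_def power_mono less_imp_le)
  have zw: "norm (z n - w n) \<le> e n" for n
  proof -
    have "z n - w n = c n - a n" by (simp add: z r y w_def)
    also have "norm \<dots> \<le> norm (c n) + norm (a n)" by (rule norm_triangle_ineq4)
    finally show ?thesis using norm_ge_zero[of "b n"] unfolding e_def by linarith
  qed
  have descent: "(norm (x (Suc n) - p))\<^sup>2 \<le> (norm (x n - p) + 7 * e n)\<^sup>2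
      - \<epsilon> * (\<kappa> * (norm (x n - q n))\<^sup>2 + (norm (z n - Q n (z n)))\<^sup>2)"
    if p: "p \<in> Z" for p n
  proof -
    have p': "p \<in> S" "p \<in> domR n" "T n (R n p) = p" using p Z by auto
    obtain H where H: "closed_half_space H" "S \<subseteq> H" "is_projector_onto (Q n) H"
      using assms(11)[of n] by blast
    have "(norm (w n - p))\<^sup>2
        \<le> (norm (x n - p) + 6 * e n)\<^sup>2 - (1 - (\<beta> n)\<^sup>2) * (norm (x n - q n))\<^sup>2"
      unfolding w_def
    proof (rule forward_backward_forward_step[OF T R lip _ xD qD p'(2,3)])
      show "\<beta> n \<le> 1" using assms(1) assms(3)[of n] by linarith
      show "q n = T n (R n (x n) + a n) + b n" by (simp only: q y)
      show "norm (a n) + norm (b n) \<le> e n" by (simp add: e_def)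
    qed
    also have "\<dots> \<le> (norm (x n - p) + 6 * e n)\<^sup>2 - \<kappa> * (norm (x n - q n))\<^sup>2"
      using mult_right_mono[OF \<kappa>_le[of n], of "(norm (x n - q n))\<^sup>2"] by simp
    finally have "(norm (x n + lam n *\<^sub>R (Q n (z n) - x n) - p))\<^sup>2
        \<le> (norm (x n - p) + 6 * e n + e n)\<^sup>2
          - \<epsilon> * (\<kappa> * (norm (x n - q n))\<^sup>2 + (norm (z n - Q n (z n)))\<^sup>2)"
    proof (rule relaxed_projected_step)
      show "(norm (Q n (z n) - p))\<^sup>2 \<le> (norm (z n - p))\<^sup>2 - (norm (z n - Q n (z n)))\<^sup>2"
        using half_space_projector_pythagoras[OF H(3,1)] H(2) p'(1) by blast
      show "0 \<le> \<kappa> * (norm (x n - q n))\<^sup>2" "0 \<le> 6 * e n" using \<kappa> e0[of n] by simp_all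
    qed (use zw assms(15) lam[of n] in \<open>simp_all only:\<close>)
    then show ?thesis by (simp only: step add.assoc) simp
  qed
  have fejer: "convergent (\<lambda>n. norm (x n - p))" if p: "p \<in> Z" for p
  proof (rule quasi_decreasing_imp_convergent)
    show "norm (x (Suc n) - p) \<le> norm (x n - p) + 7 * e n" for n
    proof (rule power2_le_imp_le)
      have "0 \<le> \<epsilon> * (\<kappa> * (norm (x n - q n))\<^sup>2 + (norm (z n - Q n (z n)))\<^sup>2)"
        using assms(15) \<kappa> by simp
      then show "(norm (x (Suc n) - p))\<^sup>2 \<le> (norm (x n - p) + 7 * e n)\<^sup>2"
        using descent[OF p, of n] by linarith
    qed (simp add: e0)
  qed (use e_sum in \<open>auto intro: summable_mult\<close>)
  have e_lim: "e \<longlonglongrightarrow> 0" using e_sum by (rule summable_LIMSEQ_zero)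
  have abc_lim: "a \<longlonglongrightarrow> 0" "b \<longlonglongrightarrow> 0" "c \<longlonglongrightarrow> 0"
    using assms(12-14) by (auto intro: tendsto_norm_zero_cancel summable_LIMSEQ_zero)
  \<comment> \<open>by \<open>descent\<close>, the gain times \<open>\<epsilon>\<close> is at most a difference of two sequences with the same limit\<close>
  have gain_lim: "(\<lambda>n. \<kappa> * (norm (x n - q n))\<^sup>2 + (norm (z n - Q n (z n)))\<^sup>2) \<longlonglongrightarrow> 0"
  proof -
    obtain p where p: "p \<in> Z" using assms(10) by blast
    then obtain L where L: "(\<lambda>n. norm (x n - p)) \<longlonglongrightarrow> L"
      using fejer by (auto simp: convergent_def)
    have "(\<lambda>n. ((norm (x n - p) + 7 * e n)\<^sup>2 - (norm (x (Suc n) - p))\<^sup>2) / \<epsilon>)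
        \<longlonglongrightarrow> ((L + 7 * 0)\<^sup>2 - L\<^sup>2) / \<epsilon>"
      using assms(15) by (intro tendsto_intros L e_lim LIMSEQ_Suc[OF L]) auto
    then have upper: "(\<lambda>n. ((norm (x n - p) + 7 * e n)\<^sup>2 - (norm (x (Suc n) - p))\<^sup>2) / \<epsilon>) \<longlonglongrightarrow> 0"
      by simp
    show ?thesis
    proof (rule tendsto_sandwich[OF _ _ tendsto_const upper]; intro always_eventually allI)
      fix n
      show "0 \<le> \<kappa> * (norm (x n - q n))\<^sup>2 + (norm (z n - Q n (z n)))\<^sup>2" using \<kappa> by simp
      show "\<kappa> * (norm (x n - q n))\<^sup>2 + (norm (z n - Q n (z n)))\<^sup>2
          \<le> ((norm (x n - p) + 7 * e n)\<^sup>2 - (norm (x (Suc n) - p))\<^sup>2) / \<epsilon>"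
        using descent[OF p, of n] assms(15) by (simp add: pos_le_divide_eq mult.commute)
    qed
  qed
  have xq_lim: "(\<lambda>n. x n - q n) \<longlonglongrightarrow> 0"
  proof -
    have "(\<lambda>n. (norm (x n - q n))\<^sup>2) \<longlonglongrightarrow> 0"
    proof (rule tendsto_sandwich[OF _ _ tendsto_const])
      show "(\<lambda>n. (\<kappa> * (norm (x n - q n))\<^sup>2 + (norm (z n - Q n (z n)))\<^sup>2) / \<kappa>) \<longlonglongrightarrow> 0"
        using tendsto_divide_zero[OF gain_lim] by simp
    qed (use \<kappa> in \<open>auto simp: field_simps\<close>)
    then show ?thesis by (simp add: tendsto_norm_zero_iff)
  qed
  have zQ_lim: "(\<lambda>n. z n - Q n (z n)) \<longlonglongrightarrow> 0"
  proof -
    have "(\<lambda>n. (norm (z n - Q n (z n)))\<^sup>2) \<longlonglongrightarrow> 0"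
      by (rule tendsto_sandwich[OF _ _ tendsto_const gain_lim]) (use \<kappa> in auto)
    then show ?thesis by (simp add: tendsto_norm_zero_iff)
  qed
  have zx_lim: "(\<lambda>n. z n - x n) \<longlonglongrightarrow> 0"
  proof -
    define h where "h n = (x n - R n (x n)) - (q n - R n (q n))" for n
    have "norm (h n) \<le> norm (x n - q n)" for n
    proof -
      have "norm (h n) \<le> \<beta> n * norm (x n - q n)"
        using lipschitz_onD[OF lip xD qD, of n] by (simp add: h_def dist_norm)
      also have "\<dots> \<le> 1 * norm (x n - q n)"
        using assms(1) assms(3)[of n] by (intro mult_right_mono) auto
      finally show ?thesis by simp
    qed
    then have "h \<longlonglongrightarrow> 0"
      by (intro Lim_null_comparison[OF _ tendsto_norm_zero[OF xq_lim]] always_eventually) blast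
    then have "(\<lambda>n. h n - (x n - q n) - a n + c n) \<longlonglongrightarrow> 0 - 0 - 0 + 0"
      by (intro tendsto_intros xq_lim abc_lim)
    also have "(\<lambda>n. h n - (x n - q n) - a n + c n) = (\<lambda>n. z n - x n)"
      by (simp add: z r y h_def fun_eq_iff)
    finally show ?thesis by simp
  qed
  have xTR_lim: "(\<lambda>n. x n - T n (R n (x n))) \<longlonglongrightarrow> 0"
  proof (rule Lim_null_comparison[OF always_eventually])
    show "\<forall>n. norm (x n - T n (R n (x n))) \<le> norm (x n - q n) + norm (a n) + norm (b n)"
    proof
      fix n
      have "x n - T n (R n (x n)) = (x n - q n) + (T n (y n) - T n (R n (x n))) + b n"
        by (simp add: q)
      also have "norm \<dots> \<le> norm (x n - q n) + norm (T n (y n) - T n (R n (x n))) + norm (b n)"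
        by (meson norm_triangle_ineq add_right_mono order_trans)
      finally have "norm (x n - T n (R n (x n)))
          \<le> norm (x n - q n) + norm (T n (y n) - T n (R n (x n))) + norm (b n)" .
      moreover have "norm (T n (y n) - T n (R n (x n))) \<le> norm (a n)"
        using firmly_nonexpansive_on_norm_le[OF T, of "y n" "R n (x n)"] by (simp add: y)
      ultimately show "norm (x n - T n (R n (x n))) \<le> norm (x n - q n) + norm (a n) + norm (b n)"
        by linarith
    qed
    have "(\<lambda>n. norm (x n - q n) + norm (a n) + norm (b n)) \<longlonglongrightarrow> 0 + 0 + 0"
      by (intro tendsto_add tendsto_norm_zero xq_lim abc_lim)
    then show "(\<lambda>n. norm (x n - q n) + norm (a n) + norm (b n)) \<longlonglongrightarrow> 0" by simp
  qed
  have cluster: "u \<in> Z" if "strict_mono k" "weakly_tendsto (\<lambda>n. x (k n)) u" for k u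
    using that xTR_lim zx_lim zQ_lim by (rule assms(26))
  with assms(10) fejer show ?thesis by (rule opial_weak_convergence)
qed

end
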